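(* Let $a>0$, $c>0$, $T>0$, let $\rho$ be an arbitrary fixed constant, and let $u=u(x,t)$ be an arbitrary solution of $$u_{tt}=\frac{1}{c^2}u_{xx}\ \text{ in } ]0,a[\,\times\,]0,T[,\qquad \frac1c u_x(a,t)+\rho\,u(a,t)=0\ \text{ for } t\in\,]0,T[,$$ $$u(x,0)=0\ \text{ in } ]0,a[,\qquad u_t(x,0)=0\ \text{ in } ]0,a[.$$ Let $M$ be a positive number such that $M\ge 2a$. Assume that $u_x(0,t)$ satisfies the following condition: there exist positive constants $C_1,C_2$ and real numbers $\tau_0\,(>0)$, $\mu_1$, $\mu_2$ such that, for all $\tau\ge\tau_0$, $$C_1\tau^{\mu_1}\le\left|\int_0^Tu_x(0,t)e^{-\tau t}\,dt\right|\le C_2\tau^{\mu_2}.$$ Let $T>Mc$. For $\tau>0$ let $$I(\tau)=\int_0^T\left(-\frac1c v_x(0,t)u(0,t)+\frac1c u_x(0,t)v(0,t)\right)dt,\qquad v(x,t)=e^{-\tau(cx+t)}.$$ Then $$\lim_{\tau\to\infty}\frac{\log|I(\tau)|}{\tau}=-2ca.$$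
   Context: $]\alpha,\beta[$ denotes an open interval. The paper does not specify a function class for solutions $u$; they are understood to be regular enough that the boundary values $u(0,t)$, $u_x(0,t)$, $u(a,t)$, the final values $u(x,T)$, $u_t(x,T)$ and integrations by parts make sense. *)

theory Defs
  imports "HOL-Analysis.Analysis"
begin

text \<open>
  Functions \<open>u x t\<close> of one space and one time variable are considered on rectangles
  \<open>X \<times> Y\<close> with intervals \<open>X\<close> and \<open>Y\<close>. The partial derivatives are taken relative to these
  intervals: they are the usual ones at interior points and the one-sided ones at end
  points belonging to the interval, so that \<open>u\<^sub>x(0,t)\<close>, \<open>u\<^sub>x(a,t)\<close>, \<open>u\<^sub>t(x,0)\<close> and \<open>u\<^sub>t(x,T)\<close>
  make sense for a function on the closed rectangle and do not depend on its values
  elsewhere.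
\<close>

definition partial_x :: "real set \<Rightarrow> (real \<Rightarrow> real \<Rightarrow> real) \<Rightarrow> real \<Rightarrow> real \<Rightarrow> real" where
  "partial_x X u x t = vector_derivative (\<lambda>y. u y t) (at x within X)"

definition partial_t :: "real set \<Rightarrow> (real \<Rightarrow> real \<Rightarrow> real) \<Rightarrow> real \<Rightarrow> real \<Rightarrow> real" where
  "partial_t Y u x t = vector_derivative (\<lambda>s. u x s) (at t within Y)"

definition C1_on :: "real set \<Rightarrow> real set \<Rightarrow> (real \<Rightarrow> real \<Rightarrow> real) \<Rightarrow> bool" where
  "C1_on X Y u \<longleftrightarrow>
     (\<forall>x\<in>X. \<forall>t\<in>Y. (\<lambda>y. u y t) differentiable (at x within X) \<and>
                     (\<lambda>s. u x s) differentiable (at t within Y)) \<and>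
     continuous_on (X \<times> Y) (\<lambda>(x, t). u x t) \<and>
     continuous_on (X \<times> Y) (\<lambda>(x, t). partial_x X u x t) \<and>
     continuous_on (X \<times> Y) (\<lambda>(x, t). partial_t Y u x t)"

definition C2_on :: "real set \<Rightarrow> real set \<Rightarrow> (real \<Rightarrow> real \<Rightarrow> real) \<Rightarrow> bool" where
  "C2_on X Y u \<longleftrightarrow>
     C1_on X Y u \<and> C1_on X Y (partial_x X u) \<and> C1_on X Y (partial_t Y u)"

definition exp_wave :: "real \<Rightarrow> real \<Rightarrow> real \<Rightarrow> real \<Rightarrow> real" where
  "exp_wave c \<tau> x t = exp (- \<tau> * (c * x + t))"

text \<open>
  The logarithm of the indicator function below vanishes in HOL when the indicator function
  does, but a nonzero limit of \<open>ln \<bar>I(\<tau>)\<bar> / \<tau>\<close> as \<open>\<tau>\<close> tends to infinity still forces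
  \<open>I(\<tau>) \<noteq> 0\<close> for all large \<open>\<tau>\<close>.
\<close>

definition indicator_fun ::
    "real \<Rightarrow> real \<Rightarrow> real \<Rightarrow> (real \<Rightarrow> real \<Rightarrow> real) \<Rightarrow> real \<Rightarrow> real" where
  "indicator_fun a c T u \<tau> =
     integral {0..T} (\<lambda>t. - (1 / c) * deriv (\<lambda>x. exp_wave c \<tau> x t) 0 * u 0 t
                          + (1 / c) * partial_x {0..a} u 0 t * exp_wave c \<tau> 0 t)"

end

theory Submission
  imports Defs "HOL-Real_Asymp.Real_Asymp"
begin

text \<open>
  Write \<open>w(x) = \<integral>\<^sub>0\<^sup>T u(x,t) exp(-\<tau>t) dt\<close> for the truncated Laplace transform. Up to a source of
  size \<open>O(\<tau> exp(-\<tau>T))\<close>, which comes from the unknown final values, \<open>w'' = c\<^sup>2\<tau>\<^sup>2w\<close>. This operator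
  factors, so the combinations \<open>p = w' + c\<tau>w\<close> and \<open>q = w' - c\<tau>w\<close> satisfy first order equations:
  across the interval \<open>p\<close> is multiplied by \<open>exp(ca\<tau>)\<close> and \<open>q\<close> by \<open>exp(-ca\<tau>)\<close>, up to the source.
  The indicator function is \<open>p(0)/c\<close>, and \<open>p(0) + q(0) = 2w'(0)\<close> is twice the transformed
  flux, which is assumed to be of polynomial size.

  The Robin condition at \<open>x = a\<close> says that \<open>p(a) = -\<kappa> q(a)\<close> with the reflection coefficient
  \<open>\<kappa> = (\<tau> - \<rho>)/(\<tau> + \<rho>)\<close>, which tends to 1. A round trip from \<open>x = 0\<close> to \<open>x = a\<close> and back
  therefore gives \<open>p(0) = -\<kappa> exp(-2ca\<tau>) q(0) + O(\<tau> exp(-\<tau>T))\<close>. Since \<open>T > Mc \<ge> 2ca\<close>, the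
  error is smaller by an exponential factor than the reflected term, and \<open>p(0) exp(2ca\<tau>)\<close> lies,
  in absolute value, between constant multiples of two powers of \<open>\<tau>\<close> (lemma
  \<open>reflected_amplitude_bounds\<close>); taking logarithms and dividing by \<open>\<tau>\<close> leaves \<open>-2ca\<close>.

  The second derivatives of \<open>u\<close> exist only in the open rectangle and need not be integrable up to
  its boundary. The first order equations are therefore obtained in integrated form, from Green's
  theorem for the pair \<open>exp(-\<tau>(kx+t)) (u\<^sub>x + k\<tau>u)\<close> and \<open>k\<^sup>2 exp(-\<tau>(kx+t)) (u\<^sub>t + \<tau>u)\<close> with
  \<open>k = \<plusminus>c\<close> (lemmas \<open>green_rectangle\<close> and \<open>wave_transport_identity\<close>).
\<close>

section \<open>Green's theorem on a rectangle and transport of boundary data\<close>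

lemma continuous_on_swap_args:
  assumes "continuous_on (A \<times> B) (\<lambda>(x, y). f x y)"
  shows "continuous_on (B \<times> A) (\<lambda>(y, x). f x y)"
proof -
  have "continuous_on (B \<times> A) ((\<lambda>(x, y). f x y) \<circ> prod.swap)"
    by (rule continuous_on_compose)
       (auto intro!: continuous_on_subset[OF assms] continuous_on_swap)
  then show ?thesis
    by (simp add: o_def case_prod_unfold prod.swap_def)
qed

lemma continuous_on_section:
  assumes "continuous_on (A \<times> B) (\<lambda>(x, y). f x y)" "x \<in> A"
  shows "continuous_on B (f x)"
proof -
  have "continuous_on B (\<lambda>y. (\<lambda>(x, y). f x y) (x, y))"
    by (rule continuous_on_compose2[OF assms(1)]) (use assms(2) in \<open>auto intro!: continuous_intros\<close>)
  then show ?thesis by simp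
qed

text \<open>
  As \<open>D\<close> may be unbounded near the boundary, its double integral need not exist. The
  identity is reached without it: differences of integrals of \<open>P\<close> and \<open>Q\<close> over growing
  rectangles are continuous on the closed interval and have zero derivative inside, first in
  \<open>t\<close> on a strip \<open>x0 \<le> x \<le> x1\<close> that avoids the lateral sides, then in \<open>x\<close>.
\<close>
lemma green_rectangle:
  fixes P Q D :: "real \<Rightarrow> real \<Rightarrow> real"
  assumes a: "0 < a" and T: "0 < T"
    and P: "continuous_on ({0..a} \<times> {0..T}) (\<lambda>(x, t). P x t)"
    and Q: "continuous_on ({0..a} \<times> {0..T}) (\<lambda>(x, t). Q x t)"
    and D: "continuous_on ({0<..<a} \<times> {0<..<T}) (\<lambda>(x, t). D x t)"
    and Px: "\<And>x t. x \<in> {0<..<a} \<Longrightarrow> t \<in> {0<..<T} \<Longrightarrow>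
               ((\<lambda>y. P y t) has_real_derivative D x t) (at x)"
    and Qt: "\<And>x t. x \<in> {0<..<a} \<Longrightarrow> t \<in> {0<..<T} \<Longrightarrow>
               ((\<lambda>s. Q x s) has_real_derivative D x t) (at t)"
  shows "integral {0..T} (P a) - integral {0..T} (P 0)
         = integral {0..a} (\<lambda>x. Q x T) - integral {0..a} (\<lambda>x. Q x 0)"
proof -
  have Q': "continuous_on ({0..T} \<times> {0..a}) (\<lambda>(t, x). Q x t)"
    and D': "continuous_on ({0<..<T} \<times> {0<..<a}) (\<lambda>(t, x). D x t)"
    using Q D by (auto intro: continuous_on_swap_args)
  have Psec: "continuous_on {0..T} (P x)" if "x \<in> {0..a}" for x
    using continuous_on_section[OF P that] .
  have Qsec: "continuous_on {0..a} (\<lambda>x. Q x t)" if "t \<in> {0..T}" for t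
    using continuous_on_section[OF Q' that] .
  have strip: "integral {0..T} (P x1) - integral {0..T} (P x0)
        = integral {x0..x1} (\<lambda>x. Q x T) - integral {x0..x1} (\<lambda>x. Q x 0)"
    if x: "0 < x0" "x0 \<le> x1" "x1 < a" for x0 x1
  proof -
    define H where "H r = integral {0..r} (\<lambda>t. P x1 t - P x0 t) - integral {x0..x1} (\<lambda>x. Q x r)" for r
    have cont: "continuous_on {0..T} (\<lambda>t. P x1 t - P x0 t)"
      using x by (intro continuous_on_diff Psec) auto
    have cQ: "continuous_on {0..T} (\<lambda>r. integral (cbox x0 x1) (\<lambda>x. Q x r))"
      by (rule integral_continuous_on_param, rule continuous_on_subset[OF Q']) (use x in auto)
    have "continuous_on {0..T} H"
      unfolding H_def
      by (intro continuous_on_diff indefinite_integral_continuous_1 integrable_continuous_real cont)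
         (use cQ in simp)
    moreover have "(H has_real_derivative 0) (at r)" if r: "0 < r" "r < T" for r
    proof -
      have d1: "((\<lambda>r. integral {0..r} (\<lambda>t. P x1 t - P x0 t)) has_real_derivative P x1 r - P x0 r) (at r)"
        by (rule integral_has_real_derivative[OF cont, of r, unfolded at_within_Icc_at[OF r]])
           (use r in simp)
      have "((\<lambda>r. integral (cbox x0 x1) (\<lambda>x. Q x r)) has_field_derivative
              integral (cbox x0 x1) (\<lambda>x. D x r)) (at r within {0<..<T})"
      proof (rule leibniz_rule_field_derivative)
        fix t y assume "t \<in> {0<..<T}" "y \<in> cbox x0 x1"
        then show "((\<lambda>x. Q y x) has_real_derivative D y t) (at t within {0<..<T})"
          using x by (auto intro: has_field_derivative_at_within[OF Qt])
      next
        fix t assume t: "t \<in> {0<..<T}"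
        show "(\<lambda>x. Q x t) integrable_on cbox x0 x1"
          by (rule integrable_continuous, rule continuous_on_subset[OF Qsec[of t]])
             (use x t in auto)
      next
        show "continuous_on ({0<..<T} \<times> cbox x0 x1) (\<lambda>(t, x). D x t)"
          by (rule continuous_on_subset[OF D']) (use x in auto)
      qed (use r in auto)
      then have d2: "((\<lambda>r. integral {x0..x1} (\<lambda>x. Q x r)) has_real_derivative
              integral {x0..x1} (\<lambda>x. D x r)) (at r)"
        using r at_within_open[of r "{0<..<T}"] by simp
      have "((\<lambda>x. D x r) has_integral P x1 r - P x0 r) {x0..x1}"
        by (rule fundamental_theorem_of_calculus)
           (use x r in \<open>auto intro!: has_field_derivative_at_within[OF Px]
              simp flip: has_real_derivative_iff_has_vector_derivative\<close>)
      with d2 have "((\<lambda>r. integral {x0..x1} (\<lambda>x. Q x r)) has_real_derivative P x1 r - P x0 r) (at r)"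
        by (simp add: integral_unique)
      from DERIV_diff[OF d1 this] show ?thesis
        unfolding H_def by simp
    qed
    ultimately have "H T = H 0"
      using DERIV_isconst_end[OF T, of H] by auto
    then have "integral {0..T} (\<lambda>t. P x1 t - P x0 t)
        = integral {x0..x1} (\<lambda>x. Q x T) - integral {x0..x1} (\<lambda>x. Q x 0)"
      by (simp add: H_def)
    then show ?thesis
      using x by (subst integral_diff[symmetric])
        (auto intro!: integrable_continuous_real Psec)
  qed
  define K where "K x = integral {0..T} (P x) - integral {0..x} (\<lambda>y. Q y T - Q y 0)" for x
  have cQ: "continuous_on {0..a} (\<lambda>y. Q y T - Q y 0)"
    using T by (intro continuous_on_diff Qsec) auto
  have cP: "continuous_on {0..a} (\<lambda>x. integral (cbox 0 T) (P x))"
    by (rule integral_continuous_on_param) (use P in auto)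
  have "continuous_on {0..a} K"
    unfolding K_def
    by (intro continuous_on_diff indefinite_integral_continuous_1 integrable_continuous_real cQ)
       (use cP in simp)
  moreover have "(K has_real_derivative 0) (at x)" if x: "0 < x" "x < a" for x
  proof -
    have eq: "K y = K (a/2)" if y: "y \<in> {0<..<a}" for y
    proof -
      have *: "K x1 = K x0" if "0 < x0" "x0 \<le> x1" "x1 < a" for x0 x1
      proof -
        have i: "(\<lambda>y. Q y T - Q y 0) integrable_on {0..x1}"
          by (rule integrable_continuous_real, rule continuous_on_subset[OF cQ]) (use that in auto)
        have i': "(\<lambda>y. Q y t) integrable_on {x0..x1}" if "t \<in> {0..T}" for t
          by (rule integrable_continuous_real, rule continuous_on_subset[OF Qsec[OF that]])
             (use \<open>0 < x0\<close> \<open>x1 < a\<close> in auto)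
        have "integral {0..x0} (\<lambda>y. Q y T - Q y 0) + integral {x0..x1} (\<lambda>y. Q y T - Q y 0)
              = integral {0..x1} (\<lambda>y. Q y T - Q y 0)"
          by (rule Henstock_Kurzweil_Integration.integral_combine) (use that i in auto)
        moreover have "integral {x0..x1} (\<lambda>y. Q y T - Q y 0)
            = integral {x0..x1} (\<lambda>x. Q x T) - integral {x0..x1} (\<lambda>x. Q x 0)"
          by (rule integral_diff) (use i' T in auto)
        ultimately show ?thesis
          using strip[OF that] by (simp add: K_def)
      qed
      show ?thesis
        using *[of y "a/2"] *[of "a/2" y] y a by (cases "y \<le> a/2") auto
    qed
    show ?thesis
    proof (rule has_field_derivative_transform_within_open)
      show "((\<lambda>_. K (a/2)) has_real_derivative 0) (at x)" by simp
      show "open {0<..<a}" by simp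
      show "x \<in> {0<..<a}" using x by simp
      show "\<And>y. y \<in> {0<..<a} \<Longrightarrow> K (a/2) = K y" by (rule eq[symmetric])
    qed
  qed
  ultimately have "K a = K 0"
    using DERIV_isconst_end[OF a, of K] by auto
  moreover have "integral {0..a} (\<lambda>y. Q y T - Q y 0)
            = integral {0..a} (\<lambda>x. Q x T) - integral {0..a} (\<lambda>x. Q x 0)"
    by (rule integral_diff) (use T in \<open>auto intro!: integrable_continuous_real Qsec\<close>)
  ultimately show ?thesis
    by (simp add: K_def)
qed

text \<open>
  The weight \<open>exp(-\<tau>(kx+t))\<close> solves the wave equation, hence the wave equation for \<open>u\<close> becomes a
  conservation law. For \<open>k = c\<close> and \<open>k = -c\<close> the identity transports \<open>p\<close> and \<open>q\<close> between
  the two ends of the interval. The initial data vanish, so only the final time contributes.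
\<close>
lemma wave_transport_identity:
  fixes u ux ut uxx utt :: "real \<Rightarrow> real \<Rightarrow> real" and k \<tau> :: real
  assumes a: "0 < a" and T: "0 < T"
    and cu: "continuous_on ({0..a} \<times> {0..T}) (\<lambda>(x, t). u x t)"
    and cux: "continuous_on ({0..a} \<times> {0..T}) (\<lambda>(x, t). ux x t)"
    and cut: "continuous_on ({0..a} \<times> {0..T}) (\<lambda>(x, t). ut x t)"
    and cuxx: "continuous_on ({0<..<a} \<times> {0<..<T}) (\<lambda>(x, t). uxx x t)"
    and dux: "\<And>x t. x \<in> {0<..<a} \<Longrightarrow> t \<in> {0<..<T} \<Longrightarrow>
               ((\<lambda>y. u y t) has_real_derivative ux x t) (at x)"
    and dut: "\<And>x t. x \<in> {0<..<a} \<Longrightarrow> t \<in> {0<..<T} \<Longrightarrow>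
               ((\<lambda>s. u x s) has_real_derivative ut x t) (at t)"
    and duxx: "\<And>x t. x \<in> {0<..<a} \<Longrightarrow> t \<in> {0<..<T} \<Longrightarrow>
               ((\<lambda>y. ux y t) has_real_derivative uxx x t) (at x)"
    and dutt: "\<And>x t. x \<in> {0<..<a} \<Longrightarrow> t \<in> {0<..<T} \<Longrightarrow>
               ((\<lambda>s. ut x s) has_real_derivative utt x t) (at t)"
    and wave: "\<And>x t. x \<in> {0<..<a} \<Longrightarrow> t \<in> {0<..<T} \<Longrightarrow> k\<^sup>2 * utt x t = uxx x t"
    and u0: "\<And>x. x \<in> {0<..<a} \<Longrightarrow> u x 0 = 0"
    and ut0: "\<And>x. x \<in> {0<..<a} \<Longrightarrow> ut x 0 = 0"
  shows "exp (- k * a * \<tau>) * integral {0..T} (\<lambda>t. (ux a t + k * \<tau> * u a t) * exp (- \<tau> * t))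
           - integral {0..T} (\<lambda>t. (ux 0 t + k * \<tau> * u 0 t) * exp (- \<tau> * t))
         = k\<^sup>2 * exp (- T * \<tau>) * integral {0..a} (\<lambda>x. exp (- k * \<tau> * x) * (ut x T + \<tau> * u x T))"
proof -
  define P where "P x t = exp (- \<tau> * (k * x + t)) * (ux x t + k * \<tau> * u x t)" for x t
  define Q where "Q x t = k\<^sup>2 * exp (- \<tau> * (k * x + t)) * (ut x t + \<tau> * u x t)" for x t
  define D where "D x t = exp (- \<tau> * (k * x + t)) * (uxx x t - k\<^sup>2 * \<tau>\<^sup>2 * u x t)" for x t
  have cu': "continuous_on ({0<..<a} \<times> {0<..<T}) (\<lambda>(x, t). u x t)"
    by (rule continuous_on_subset[OF cu]) auto
  have split1: "exp (- \<tau> * (k * a + t)) = exp (- k * a * \<tau>) * exp (- \<tau> * t)"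
    and split2: "exp (- \<tau> * (k * x + T)) = exp (- T * \<tau>) * exp (- k * \<tau> * x)" for t x
    by (simp_all add: mult_exp_exp algebra_simps)
  have green: "integral {0..T} (P a) - integral {0..T} (P 0)
         = integral {0..a} (\<lambda>x. Q x T) - integral {0..a} (\<lambda>x. Q x 0)"
  proof (rule green_rectangle[OF a T, where D = D])
    show "continuous_on ({0..a} \<times> {0..T}) (\<lambda>(x, t). P x t)"
      using cu cux unfolding P_def case_prod_unfold by (intro continuous_intros)
    show "continuous_on ({0..a} \<times> {0..T}) (\<lambda>(x, t). Q x t)"
      using cu cut unfolding Q_def case_prod_unfold by (intro continuous_intros)
    show "continuous_on ({0<..<a} \<times> {0<..<T}) (\<lambda>(x, t). D x t)"
      using cu' cuxx unfolding D_def case_prod_unfold by (intro continuous_intros)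
  next
    fix x t assume xt: "x \<in> {0<..<a}" "t \<in> {0<..<T}"
    show "((\<lambda>y. P y t) has_real_derivative D x t) (at x)"
      unfolding P_def D_def
      by (rule derivative_eq_intros refl dux[OF xt] duxx[OF xt])+
         (simp add: algebra_simps power2_eq_square)
    have "((\<lambda>s. Q x s) has_real_derivative
            k\<^sup>2 * (exp (- \<tau> * (k * x + t)) * (utt x t - \<tau>\<^sup>2 * u x t))) (at t)"
      unfolding Q_def
      by (rule derivative_eq_intros refl dut[OF xt] dutt[OF xt])+
         (simp add: algebra_simps power2_eq_square)
    also have "k\<^sup>2 * (exp (- \<tau> * (k * x + t)) * (utt x t - \<tau>\<^sup>2 * u x t)) = D x t"
      unfolding D_def wave[OF xt, symmetric] by (simp add: algebra_simps)
    finally show "((\<lambda>s. Q x s) has_real_derivative D x t) (at t)" .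
  qed
  have Pa: "integral {0..T} (P a)
      = exp (- k * a * \<tau>) * integral {0..T} (\<lambda>t. (ux a t + k * \<tau> * u a t) * exp (- \<tau> * t))"
    unfolding integral_mult_right[symmetric]
    by (rule integral_cong) (simp only: P_def split1, simp only: mult_ac)
  have P0: "integral {0..T} (P 0)
      = integral {0..T} (\<lambda>t. (ux 0 t + k * \<tau> * u 0 t) * exp (- \<tau> * t))"
    by (rule integral_cong) (simp add: P_def)
  have QT: "integral {0..a} (\<lambda>x. Q x T)
      = k\<^sup>2 * exp (- T * \<tau>) * integral {0..a} (\<lambda>x. exp (- k * \<tau> * x) * (ut x T + \<tau> * u x T))"
    unfolding integral_mult_right[symmetric]
    by (rule integral_cong) (simp only: Q_def split2 mult.assoc)
  have Q0: "integral {0..a} (\<lambda>x. Q x 0) = integral {0..a} (\<lambda>_. 0)"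
    by (rule integral_spike[of "{0, a}"]) (auto simp: Q_def u0 ut0)
  show ?thesis
    using green unfolding Pa P0 QT Q0 integral_0 diff_0_right .
qed

section \<open>Asymptotics of the reflected amplitude\<close>

lemma ln_abs_over_tendsto:
  fixes J :: "real \<Rightarrow> real"
  assumes "0 < A" "0 < B"
    and lower: "\<forall>\<^sub>F \<tau> in at_top. A * \<tau> powr \<mu> \<le> \<bar>J \<tau>\<bar> * exp (b * \<tau>)"
    and upper: "\<forall>\<^sub>F \<tau> in at_top. \<bar>J \<tau>\<bar> * exp (b * \<tau>) \<le> B * \<tau> powr \<nu>"
  shows "((\<lambda>\<tau>. ln \<bar>J \<tau>\<bar> / \<tau>) \<longlongrightarrow> - b) at_top"
proof (rule tendsto_sandwich)
  have *: "((\<lambda>\<tau>. (ln C + \<kappa> * ln \<tau>) / \<tau> - b) \<longlongrightarrow> - b) at_top" if "0 < C" for C \<kappa> :: real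
    by real_asymp
  show "((\<lambda>\<tau>. (ln A + \<mu> * ln \<tau>) / \<tau> - b) \<longlongrightarrow> - b) at_top"
    and "((\<lambda>\<tau>. (ln B + \<nu> * ln \<tau>) / \<tau> - b) \<longlongrightarrow> - b) at_top"
    using * assms by auto
  have "\<forall>\<^sub>F \<tau> in at_top. (ln A + \<mu> * ln \<tau>) / \<tau> - b \<le> ln \<bar>J \<tau>\<bar> / \<tau> \<and>
          ln \<bar>J \<tau>\<bar> / \<tau> \<le> (ln B + \<nu> * ln \<tau>) / \<tau> - b"
    using lower upper eventually_gt_at_top[of 0]
  proof eventually_elim
    case (elim \<tau>)
    have pos: "0 < A * \<tau> powr \<mu>" using assms elim by simp
    then have "0 < \<bar>J \<tau>\<bar> * exp (b * \<tau>)" using elim by linarith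
    then have J: "0 < \<bar>J \<tau>\<bar>" by (simp add: zero_less_mult_iff)
    have "ln (A * \<tau> powr \<mu>) \<le> ln (\<bar>J \<tau>\<bar> * exp (b * \<tau>))"
      and "ln (\<bar>J \<tau>\<bar> * exp (b * \<tau>)) \<le> ln (B * \<tau> powr \<nu>)"
      using pos J elim assms by simp_all
    then have "ln A + \<mu> * ln \<tau> \<le> ln \<bar>J \<tau>\<bar> + b * \<tau>" "ln \<bar>J \<tau>\<bar> + b * \<tau> \<le> ln B + \<nu> * ln \<tau>"
      using J elim assms by (simp_all add: ln_mult ln_powr)
    then have "(ln A + \<mu> * ln \<tau> - b * \<tau>) / \<tau> \<le> ln \<bar>J \<tau>\<bar> / \<tau>"
      "ln \<bar>J \<tau>\<bar> / \<tau> \<le> (ln B + \<nu> * ln \<tau> - b * \<tau>) / \<tau>"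
      using elim by (simp_all add: divide_right_mono)
    then show ?case using elim by (simp add: diff_divide_distrib)
  qed
  then show "\<forall>\<^sub>F \<tau> in at_top. (ln A + \<mu> * ln \<tau>) / \<tau> - b \<le> ln \<bar>J \<tau>\<bar> / \<tau>"
    and "\<forall>\<^sub>F \<tau> in at_top. ln \<bar>J \<tau>\<bar> / \<tau> \<le> (ln B + \<nu> * ln \<tau>) / \<tau> - b"
    by (simp_all add: eventually_conj_iff)
qed

text \<open>
  One round trip over an interval of travel time \<open>l\<close>. Eliminating \<open>pa\<close>, \<open>qa\<close> and \<open>q0\<close> gives
  \<open>p0 (1 - \<kappa> exp(-2l\<tau>)) = -2\<kappa> exp(-2l\<tau>) w + error\<close> with \<open>w = (p0 + q0)/2\<close>. For large \<open>\<tau>\<close> the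
  factor on the left is at least 1/2 and \<open>\<kappa>\<close> lies between 1/2 and 2; after multiplication
  by \<open>exp(2l\<tau>)\<close> the error is below half of the lower bound for \<open>w\<close>, because \<open>2l < T\<close>.
  The constant 9 arises as \<open>2 (2 \<cdot> 2 + 1/2)\<close>.
\<close>
lemma reflected_amplitude_bounds:
  fixes p0 pa q0 qa :: "real \<Rightarrow> real" and \<rho> l T E L U \<mu> \<nu> :: real
  assumes l: "0 < l" and T: "2 * l < T" and L: "0 < L"
    and right: "\<And>\<tau>. \<tau> > 0 \<Longrightarrow> \<bar>exp (- l * \<tau>) * pa \<tau> - p0 \<tau>\<bar> \<le> E * (1 + \<tau>) * exp (- T * \<tau>)"
    and left: "\<And>\<tau>. \<tau> > 0 \<Longrightarrow> \<bar>qa \<tau> - exp (- l * \<tau>) * q0 \<tau>\<bar> \<le> E * (1 + \<tau>) * exp (- T * \<tau>)"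
    and robin: "\<And>\<tau>. (\<tau> + \<rho>) * pa \<tau> = - (\<tau> - \<rho>) * qa \<tau>"
    and data: "\<forall>\<^sub>F \<tau> in at_top. L * \<tau> powr \<mu> \<le> \<bar>(p0 \<tau> + q0 \<tau>) / 2\<bar> \<and> \<bar>(p0 \<tau> + q0 \<tau>) / 2\<bar> \<le> U * \<tau> powr \<nu>"
  shows "\<forall>\<^sub>F \<tau> in at_top. L / 2 * \<tau> powr \<mu> \<le> \<bar>p0 \<tau>\<bar> * exp (2 * l * \<tau>)"
    and "\<forall>\<^sub>F \<tau> in at_top. \<bar>p0 \<tau>\<bar> * exp (2 * l * \<tau>) \<le> 9 * U * \<tau> powr \<nu>"
proof -
  have "T - 2 * l > 0" using T by simp
  then have "((\<lambda>\<tau>. 3 * E * (1 + \<tau>) * exp (- (T - 2 * l) * \<tau>) / \<tau> powr \<mu>) \<longlongrightarrow> 0) at_top"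
    by real_asymp
  then have small: "\<forall>\<^sub>F \<tau> in at_top. 3 * E * (1 + \<tau>) * exp (- (T - 2 * l) * \<tau>) / \<tau> powr \<mu> < L / 2"
    using L by (intro order_tendstoD(2)) auto
  have "((\<lambda>\<tau>. (\<tau> - \<rho>) / (\<tau> + \<rho>)) \<longlongrightarrow> 1) at_top" by real_asymp
  from order_tendstoD(1)[OF this, of "1/2"] order_tendstoD(2)[OF this, of 2]
  have kap: "\<forall>\<^sub>F \<tau> in at_top. 1/2 < (\<tau> - \<rho>) / (\<tau> + \<rho>)" "\<forall>\<^sub>F \<tau> in at_top. (\<tau> - \<rho>) / (\<tau> + \<rho>) < 2"
    by simp_all
  have "((\<lambda>\<tau>. exp (- 2 * l * \<tau>)) \<longlongrightarrow> 0) at_top" using l by real_asymp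
  from order_tendstoD(2)[OF this, of "1/4"]
  have ex: "\<forall>\<^sub>F \<tau> in at_top. exp (- 2 * l * \<tau>) < 1 / 4"
    by simp
  have "\<forall>\<^sub>F \<tau> in at_top. L / 2 * \<tau> powr \<mu> \<le> \<bar>p0 \<tau>\<bar> * exp (2 * l * \<tau>) \<and>
          \<bar>p0 \<tau>\<bar> * exp (2 * l * \<tau>) \<le> 9 * U * \<tau> powr \<nu>"
    using small kap ex data eventually_gt_at_top[of 0] eventually_gt_at_top[of "\<bar>\<rho>\<bar>"]
  proof eventually_elim
    case (elim \<tau>)
    define \<kappa> where "\<kappa> = (\<tau> - \<rho>) / (\<tau> + \<rho>)"
    define e where "e = exp (- l * \<tau>)"
    define w where "w = (p0 \<tau> + q0 \<tau>) / 2"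
    define B where "B = E * (1 + \<tau>) * exp (- T * \<tau>)"
    define E1 where "E1 = e * pa \<tau> - p0 \<tau>"
    define E2 where "E2 = qa \<tau> - e * q0 \<tau>"
    have E12: "\<bar>E1\<bar> \<le> B" "\<bar>E2\<bar> \<le> B"
      using right[of \<tau>] left[of \<tau>] elim by (simp_all add: B_def E1_def E2_def e_def)
    have \<kappa>: "1/2 < \<kappa>" "\<kappa> < 2" using elim by (simp_all add: \<kappa>_def)
    have "(\<tau> + \<rho>) \<noteq> 0" using elim by linarith
    then have pa: "pa \<tau> = - \<kappa> * qa \<tau>"
      using robin[of \<tau>] by (simp add: \<kappa>_def field_simps)
    have e: "0 < e" "e \<le> 1" using l elim by (simp_all add: e_def)
    have e2: "e\<^sup>2 = exp (- 2 * l * \<tau>)" by (simp add: e_def power2_eq_square exp_add[symmetric])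
    then have e4: "e\<^sup>2 < 1/4" "e\<^sup>2 * exp (2 * l * \<tau>) = 1" using elim by (simp_all add: exp_add[symmetric])
    define X where "X = exp (2 * l * \<tau>)"
    define y where "y = p0 \<tau> * X"
    define R where "R = (\<kappa> * e * E2 + E1) * X"
    have q0: "q0 \<tau> = 2 * w - p0 \<tau>" by (simp add: w_def field_simps)
    have "p0 \<tau> = - \<kappa> * e * (e * q0 \<tau> + E2) - E1"
      using pa by (simp add: E1_def E2_def algebra_simps)
    also have "\<dots> = - \<kappa> * e\<^sup>2 * (2 * w - p0 \<tau>) - (\<kappa> * e * E2 + E1)"
      unfolding q0 by (simp add: power2_eq_square algebra_simps)
    finally have "y = (- \<kappa> * e\<^sup>2 * (2 * w - p0 \<tau>) - (\<kappa> * e * E2 + E1)) * X"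
      by (simp add: y_def)
    also have "\<dots> = - \<kappa> * (e\<^sup>2 * X) * (2 * w) + \<kappa> * e\<^sup>2 * y - R"
      unfolding y_def R_def by (simp add: algebra_simps)
    finally have "y = - \<kappa> * (e\<^sup>2 * X) * (2 * w) + \<kappa> * e\<^sup>2 * y - R" .
    then have y: "y * (1 - \<kappa> * e\<^sup>2) = - (2 * \<kappa> * w) - R"
      unfolding e4(2)[folded X_def] by (simp add: algebra_simps)
    have R: "\<bar>R\<bar> \<le> L / 2 * \<tau> powr \<mu>"
    proof -
      have "\<bar>\<kappa> * e * E2\<bar> \<le> 2 * 1 * B"
        unfolding abs_mult using \<kappa> e E12 by (intro mult_mono) auto
      then have "\<bar>\<kappa> * e * E2 + E1\<bar> \<le> 3 * B" using E12 by linarith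
      then have "\<bar>R\<bar> \<le> 3 * B * exp (2 * l * \<tau>)"
        unfolding R_def X_def abs_mult by (intro mult_mono) auto
      also have "\<dots> = 3 * E * (1 + \<tau>) * exp (- (T - 2 * l) * \<tau>)"
        by (simp add: B_def mult_exp_exp algebra_simps)
      also have "\<dots> \<le> L / 2 * \<tau> powr \<mu>"
        using elim by (simp add: field_simps)
      finally show ?thesis .
    qed
    have w: "L * \<tau> powr \<mu> \<le> \<bar>w\<bar>" "\<bar>w\<bar> \<le> U * \<tau> powr \<nu>" using elim by (simp_all add: w_def)
    have ke: "0 \<le> \<kappa> * e\<^sup>2" "\<kappa> * e\<^sup>2 \<le> 2 * (1/4)"
      using \<kappa> e4(1) mult_mono[of \<kappa> 2 "e\<^sup>2" "1/4"] by simp_all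
    have kw: "\<bar>w\<bar> \<le> \<bar>2 * \<kappa> * w\<bar>" "\<bar>2 * \<kappa> * w\<bar> \<le> 4 * \<bar>w\<bar>"
      using \<kappa> mult_right_mono[of 1 "2 * \<kappa>" "\<bar>w\<bar>"] mult_right_mono[of "2 * \<kappa>" 4 "\<bar>w\<bar>"]
      by (auto simp: abs_mult)
    have yy: "\<bar>y * (1 - \<kappa> * e\<^sup>2)\<bar> = \<bar>y\<bar> * (1 - \<kappa> * e\<^sup>2)" using ke by (simp add: abs_mult)
    have "\<bar>y\<bar> * (1 - \<kappa> * e\<^sup>2) \<le> \<bar>y\<bar> * 1" "\<bar>y\<bar> * (1/2) \<le> \<bar>y\<bar> * (1 - \<kappa> * e\<^sup>2)"
      by (rule mult_left_mono; use ke in simp)+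
    then have "L / 2 * \<tau> powr \<mu> \<le> \<bar>y\<bar>" "\<bar>y\<bar> \<le> 9 * (U * \<tau> powr \<nu>)"
      using yy y R w kw by linarith+
    then show ?case by (simp add: y_def X_def abs_mult)
  qed
  then show "\<forall>\<^sub>F \<tau> in at_top. L / 2 * \<tau> powr \<mu> \<le> \<bar>p0 \<tau>\<bar> * exp (2 * l * \<tau>)"
    and "\<forall>\<^sub>F \<tau> in at_top. \<bar>p0 \<tau>\<bar> * exp (2 * l * \<tau>) \<le> 9 * U * \<tau> powr \<nu>"
    by (simp_all add: eventually_conj_iff)
qed

section \<open>The indicator function\<close>

lemma partial_x_eq_open:
  "x \<in> {\<alpha><..<\<beta>} \<Longrightarrow> partial_x {\<alpha><..<\<beta>} u x t = partial_x {\<alpha>..\<beta>} u x t"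
  by (simp add: partial_x_def at_within_open_NO_MATCH at_within_Icc_at)

lemma partial_t_eq_open:
  "t \<in> {\<alpha><..<\<beta>} \<Longrightarrow> partial_t {\<alpha><..<\<beta>} u x t = partial_t {\<alpha>..\<beta>} u x t"
  by (simp add: partial_t_def at_within_open_NO_MATCH at_within_Icc_at)

lemma C1_on_has_derivatives:
  assumes "C1_on {\<alpha><..<\<beta>} {\<gamma><..<\<delta>} u" "x \<in> {\<alpha><..<\<beta>}" "t \<in> {\<gamma><..<\<delta>}"
  shows "((\<lambda>y. u y t) has_real_derivative partial_x {\<alpha><..<\<beta>} u x t) (at x)"
    and "((\<lambda>s. u x s) has_real_derivative partial_t {\<gamma><..<\<delta>} u x t) (at t)"
proof -
  have "(\<lambda>y. u y t) differentiable (at x)" "(\<lambda>s. u x s) differentiable (at t)"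
    using assms at_within_open[of x "{\<alpha><..<\<beta>}"] at_within_open[of t "{\<gamma><..<\<delta>}"]
    unfolding C1_on_def by force+
  then show "((\<lambda>y. u y t) has_real_derivative partial_x {\<alpha><..<\<beta>} u x t) (at x)"
    and "((\<lambda>s. u x s) has_real_derivative partial_t {\<gamma><..<\<delta>} u x t) (at t)"
    using assms(2,3)
    by (simp_all add: has_real_derivative_iff_has_vector_derivative vector_derivative_works
          partial_x_def partial_t_def at_within_open_NO_MATCH)
qed

theorem theorem5p1:
  fixes a c T \<rho> M C\<^sub>1 C\<^sub>2 \<tau>\<^sub>0 \<mu>\<^sub>1 \<mu>\<^sub>2 :: real
    and u :: "real \<Rightarrow> real \<Rightarrow> real"
  assumes "a > 0" and "c > 0" and "T > 0"
    and "C1_on {0..a} {0..T} u"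
    and "C2_on {0<..<a} {0<..<T} u"
    and "\<And>x t. x \<in> {0<..<a} \<Longrightarrow> t \<in> {0<..<T} \<Longrightarrow>
           partial_t {0<..<T} (partial_t {0<..<T} u) x t
           = 1 / c\<^sup>2 * partial_x {0<..<a} (partial_x {0<..<a} u) x t"
    and "\<And>t. t \<in> {0<..<T} \<Longrightarrow> 1 / c * partial_x {0..a} u a t + \<rho> * u a t = 0"
    and "\<And>x. x \<in> {0<..<a} \<Longrightarrow> u x 0 = 0"
    and "\<And>x. x \<in> {0<..<a} \<Longrightarrow> partial_t {0..T} u x 0 = 0"
    and "M > 0" and "M \<ge> 2 * a"
    and "C\<^sub>1 > 0" and "C\<^sub>2 > 0" and "\<tau>\<^sub>0 > 0"
    and "\<And>\<tau>. \<tau> \<ge> \<tau>\<^sub>0 \<Longrightarrow>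
           C\<^sub>1 * \<tau> powr \<mu>\<^sub>1 \<le> \<bar>integral {0..T} (\<lambda>t. partial_x {0..a} u 0 t * exp (- \<tau> * t))\<bar> \<and>
           \<bar>integral {0..T} (\<lambda>t. partial_x {0..a} u 0 t * exp (- \<tau> * t))\<bar> \<le> C\<^sub>2 * \<tau> powr \<mu>\<^sub>2"
    and "T > M * c"
  shows "((\<lambda>\<tau>. ln \<bar>indicator_fun a c T u \<tau>\<bar> / \<tau>) \<longlongrightarrow> - 2 * c * a) at_top"
proof -
  define ux where "ux = partial_x {0..a} u"
  define ut where "ut = partial_t {0..T} u"
  define uxx where "uxx = partial_x {0<..<a} (partial_x {0<..<a} u)"
  define utt where "utt = partial_t {0<..<T} (partial_t {0<..<T} u)"
  have cu: "continuous_on ({0..a} \<times> {0..T}) (\<lambda>(x, t). u x t)"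
    and cux: "continuous_on ({0..a} \<times> {0..T}) (\<lambda>(x, t). ux x t)"
    and cut: "continuous_on ({0..a} \<times> {0..T}) (\<lambda>(x, t). ut x t)"
    using assms(4) by (auto simp: C1_on_def ux_def ut_def)
  have C1s: "C1_on {0<..<a} {0<..<T} u" "C1_on {0<..<a} {0<..<T} (partial_x {0<..<a} u)"
     "C1_on {0<..<a} {0<..<T} (partial_t {0<..<T} u)"
    using assms(5) by (auto simp: C2_on_def)
  have cuxx: "continuous_on ({0<..<a} \<times> {0<..<T}) (\<lambda>(x, t). uxx x t)"
    using C1s(2) by (auto simp: C1_on_def uxx_def)
  have der:
    "((\<lambda>y. u y t) has_real_derivative ux x t) (at x)"
    "((\<lambda>s. u x s) has_real_derivative ut x t) (at t)"
    "((\<lambda>y. ux y t) has_real_derivative uxx x t) (at x)"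
    "((\<lambda>s. ut x s) has_real_derivative utt x t) (at t)"
    if xt: "x \<in> {0<..<a}" "t \<in> {0<..<T}" for x t
  proof -
    show "((\<lambda>y. u y t) has_real_derivative ux x t) (at x)"
      "((\<lambda>s. u x s) has_real_derivative ut x t) (at t)"
      using C1_on_has_derivatives[OF C1s(1) xt] xt
      by (simp_all add: partial_x_eq_open partial_t_eq_open ux_def ut_def)
    show "((\<lambda>y. ux y t) has_real_derivative uxx x t) (at x)"
      by (rule has_field_derivative_transform_within_open[of _ _ _ "{0<..<a}",
            OF C1_on_has_derivatives(1)[OF C1s(2) xt, folded uxx_def]])
         (use xt in \<open>simp_all add: partial_x_eq_open ux_def\<close>)
    show "((\<lambda>s. ut x s) has_real_derivative utt x t) (at t)"
      by (rule has_field_derivative_transform_within_open[of _ _ _ "{0<..<T}",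
            OF C1_on_has_derivatives(2)[OF C1s(3) xt, folded utt_def]])
         (use xt in \<open>simp_all add: partial_t_eq_open ut_def\<close>)
  qed
  \<comment> \<open>\<open>F c x \<tau>\<close> and \<open>F (- c) x \<tau>\<close> are \<open>p(x)\<close> and \<open>q(x)\<close>, and \<open>c\<^sup>2 exp(-T\<tau>) G\<close> is the
     contribution of the final values.\<close>
  define F where "F k x \<tau> = integral {0..T} (\<lambda>t. (ux x t + k * \<tau> * u x t) * exp (- \<tau> * t))"
    for k x \<tau>
  define G where "G k \<tau> = integral {0..a} (\<lambda>x. exp (- k * \<tau> * x) * (ut x T + \<tau> * u x T))" for k \<tau>
  have transport: "exp (- k * a * \<tau>) * F k a \<tau> - F k 0 \<tau> = c\<^sup>2 * exp (- T * \<tau>) * G k \<tau>"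
    if k: "k\<^sup>2 = c\<^sup>2" for k \<tau>
    unfolding F_def G_def k[symmetric]
    by (rule wave_transport_identity[OF assms(1,3) cu cux cut cuxx der])
       (use assms(2,6,8,9) k in \<open>simp_all add: uxx_def utt_def ut_def\<close>)
  have cuT: "continuous_on {0..a} (\<lambda>x. u x T)"
    using continuous_on_section[OF continuous_on_swap_args[OF cu], of T] assms(3) by simp
  have cutT: "continuous_on {0..a} (\<lambda>x. ut x T)"
    using continuous_on_section[OF continuous_on_swap_args[OF cut], of T] assms(3) by simp
  obtain B1 where B1: "\<And>x. x \<in> {0..a} \<Longrightarrow> \<bar>u x T\<bar> \<le> B1"
    using compact_imp_bounded[OF compact_continuous_image[OF cuT compact_Icc]]
    unfolding bounded_iff by (metis imageI real_norm_def)
  obtain B2 where B2: "\<And>x. x \<in> {0..a} \<Longrightarrow> \<bar>ut x T\<bar> \<le> B2"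
    using compact_imp_bounded[OF compact_continuous_image[OF cutT compact_Icc]]
    unfolding bounded_iff by (metis imageI real_norm_def)
  define B where "B = max B1 B2"
  have B: "\<bar>u x T\<bar> \<le> B" "\<bar>ut x T\<bar> \<le> B" if "x \<in> {0..a}" for x
    using B1[OF that] B2[OF that] by (auto simp: B_def)
  have G: "\<bar>G k \<tau>\<bar> \<le> m * (B * (1 + \<tau>)) * a"
    if \<tau>: "\<tau> > 0" and m: "\<And>x. x \<in> {0..a} \<Longrightarrow> exp (- k * \<tau> * x) \<le> m" for k \<tau> m
  proof -
    have "norm (G k \<tau>) \<le> m * (B * (1 + \<tau>)) * (a - 0)"
      unfolding G_def
    proof (rule integral_bound)
      show "continuous_on {0..a} (\<lambda>x. exp (- k * \<tau> * x) * (ut x T + \<tau> * u x T))"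
        by (intro continuous_intros cuT cutT)
      fix x assume x: "x \<in> {0..a}"
      have "\<bar>\<tau> * u x T\<bar> \<le> \<tau> * B" using B(1)[OF x] \<tau> by (simp add: abs_mult)
      then have "\<bar>ut x T + \<tau> * u x T\<bar> \<le> B * (1 + \<tau>)"
        using B(2)[OF x] by (simp add: algebra_simps)
      moreover have "0 \<le> m" using m[OF x] exp_ge_zero[of "- k * \<tau> * x"] by linarith
      ultimately show "norm (exp (- k * \<tau> * x) * (ut x T + \<tau> * u x T)) \<le> m * (B * (1 + \<tau>))"
        using m[OF x] by (simp add: abs_mult mult_mono)
    qed (use assms(1) in simp)
    then show ?thesis by simp
  qed
  define E where "E = c\<^sup>2 * B * a"
  have right: "\<bar>exp (- (c * a) * \<tau>) * F c a \<tau> - F c 0 \<tau>\<bar> \<le> E * (1 + \<tau>) * exp (- T * \<tau>)"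
    if \<tau>: "\<tau> > 0" for \<tau>
  proof -
    have "\<bar>G c \<tau>\<bar> \<le> 1 * (B * (1 + \<tau>)) * a"
      by (rule G[OF \<tau>]) (use assms(2) \<tau> in simp)
    then have "c\<^sup>2 * exp (- T * \<tau>) * \<bar>G c \<tau>\<bar> \<le> c\<^sup>2 * exp (- T * \<tau>) * (1 * (B * (1 + \<tau>)) * a)"
      by (intro mult_left_mono) auto
    then show ?thesis
      using transport[of c \<tau>] by (simp add: abs_mult E_def mult_ac)
  qed
  \<comment> \<open>For \<open>k = -c\<close> the weight grows up to \<open>exp(ca\<tau>)\<close>. Solving for the value at \<open>a\<close> instead of \<open>0\<close>
     puts the factor \<open>exp(-ca\<tau>)\<close> in front, so that the source stays of size \<open>exp(-T\<tau>)\<close>.\<close>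
  have left: "\<bar>F (- c) a \<tau> - exp (- (c * a) * \<tau>) * F (- c) 0 \<tau>\<bar> \<le> E * (1 + \<tau>) * exp (- T * \<tau>)"
    if \<tau>: "\<tau> > 0" for \<tau>
  proof -
    have "\<bar>G (- c) \<tau>\<bar> \<le> exp (c * a * \<tau>) * (B * (1 + \<tau>)) * a"
      by (rule G[OF \<tau>]) (use assms(2) \<tau> in simp)
    then have "c\<^sup>2 * exp (- T * \<tau>) * exp (- (c * a) * \<tau>) * \<bar>G (- c) \<tau>\<bar>
        \<le> c\<^sup>2 * exp (- T * \<tau>) * exp (- (c * a) * \<tau>) * (exp (c * a * \<tau>) * (B * (1 + \<tau>)) * a)"
      by (intro mult_left_mono) auto
    also have "\<dots> = E * (1 + \<tau>) * exp (- T * \<tau>) * (exp (- (c * a) * \<tau>) * exp (c * a * \<tau>))"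
      by (simp add: E_def mult_ac)
    also have "\<dots> = E * (1 + \<tau>) * exp (- T * \<tau>)" by (simp add: mult_exp_exp)
    finally have *: "c\<^sup>2 * exp (- T * \<tau>) * exp (- (c * a) * \<tau>) * \<bar>G (- c) \<tau>\<bar> \<le> E * (1 + \<tau>) * exp (- T * \<tau>)" .
    have "F (- c) a \<tau> - exp (- (c * a) * \<tau>) * F (- c) 0 \<tau>
        = exp (- (c * a) * \<tau>) * (exp (c * a * \<tau>) * F (- c) a \<tau> - F (- c) 0 \<tau>)"
      by (simp add: right_diff_distrib mult.assoc[symmetric] mult_exp_exp)
    also have "\<dots> = exp (- (c * a) * \<tau>) * (c\<^sup>2 * exp (- T * \<tau>) * G (- c) \<tau>)"
      using transport[of "- c" \<tau>] by simp
    finally show ?thesis using * by (simp add: abs_mult mult_ac)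
  qed
  have int: "(\<lambda>t. (ux x t + k * \<tau> * u x t) * exp (- \<tau> * t)) integrable_on {0..T}"
    if "x \<in> {0..a}" for x k \<tau>
    by (intro integrable_continuous_real continuous_intros continuous_on_section[OF cux that]
          continuous_on_section[OF cu that])
  have robin: "(\<tau> + \<rho>) * F c a \<tau> = - (\<tau> - \<rho>) * F (- c) a \<tau>" for \<tau>
    unfolding F_def integral_mult_right[symmetric]
  proof (rule integral_spike[of "{0, T}"])
    fix t assume "t \<in> {0..T} - {0, T}"
    then have "ux a t = - (c * \<rho> * u a t)"
      using assms(7)[of t] assms(2) by (simp add: ux_def field_simps)
    then show "- (\<tau> - \<rho>) * ((ux a t + - c * \<tau> * u a t) * exp (- \<tau> * t))
        = (\<tau> + \<rho>) * ((ux a t + c * \<tau> * u a t) * exp (- \<tau> * t))"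
      by (simp add: algebra_simps)
  qed simp
  have sum: "(F c 0 \<tau> + F (- c) 0 \<tau>) / 2 = integral {0..T} (\<lambda>t. ux 0 t * exp (- \<tau> * t))" for \<tau>
  proof -
    have "F c 0 \<tau> + F (- c) 0 \<tau>
        = integral {0..T} (\<lambda>t. (ux 0 t + c * \<tau> * u 0 t) * exp (- \<tau> * t)
                                + (ux 0 t + - c * \<tau> * u 0 t) * exp (- \<tau> * t))"
      unfolding F_def by (rule integral_add[symmetric]; rule int; use assms(1) in simp)
    also have "\<dots> = integral {0..T} (\<lambda>t. 2 * (ux 0 t * exp (- \<tau> * t)))"
      by (rule integral_cong) (simp add: algebra_simps)
    finally have "F c 0 \<tau> + F (- c) 0 \<tau> = integral {0..T} (\<lambda>t. 2 * (ux 0 t * exp (- \<tau> * t)))" .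
    then show ?thesis by simp
  qed
  have data: "\<forall>\<^sub>F \<tau> in at_top. C\<^sub>1 * \<tau> powr \<mu>\<^sub>1 \<le> \<bar>(F c 0 \<tau> + F (- c) 0 \<tau>) / 2\<bar> \<and>
      \<bar>(F c 0 \<tau> + F (- c) 0 \<tau>) / 2\<bar> \<le> C\<^sub>2 * \<tau> powr \<mu>\<^sub>2"
    unfolding sum ux_def using eventually_ge_at_top[of \<tau>\<^sub>0] by eventually_elim (rule assms(15))
  have len: "0 < c * a" "2 * (c * a) < T"
  proof -
    show "0 < c * a" using assms(1,2) by simp
    have "2 * a * c \<le> M * c" using assms(2,11) by (intro mult_right_mono) auto
    then show "2 * (c * a) < T" using assms(16) by (simp add: mult_ac)
  qed
  have lower: "\<forall>\<^sub>F \<tau> in at_top. C\<^sub>1 / 2 * \<tau> powr \<mu>\<^sub>1 \<le> \<bar>F c 0 \<tau>\<bar> * exp (2 * (c * a) * \<tau>)"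
    by (rule reflected_amplitude_bounds(1)[OF len assms(12) right left robin data])
  have upper: "\<forall>\<^sub>F \<tau> in at_top. \<bar>F c 0 \<tau>\<bar> * exp (2 * (c * a) * \<tau>) \<le> 9 * C\<^sub>2 * \<tau> powr \<mu>\<^sub>2"
    by (rule reflected_amplitude_bounds(2)[OF len assms(12) right left robin data])
  have ind: "indicator_fun a c T u \<tau> = F c 0 \<tau> / c" for \<tau>
  proof -
    have "deriv (\<lambda>x. exp_wave c \<tau> x t) 0 = - \<tau> * c * exp (- \<tau> * t)" for t
      unfolding exp_wave_def by (rule DERIV_imp_deriv) (auto intro!: derivative_eq_intros)
    then have "indicator_fun a c T u \<tau>
        = integral {0..T} (\<lambda>t. 1 / c * ((ux 0 t + c * \<tau> * u 0 t) * exp (- \<tau> * t)))"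
      unfolding indicator_fun_def ux_def
      by (intro integral_cong) (simp add: exp_wave_def assms(2) field_simps)
    then show ?thesis by (simp add: F_def)
  qed
  have "((\<lambda>\<tau>. ln \<bar>indicator_fun a c T u \<tau>\<bar> / \<tau>) \<longlongrightarrow> - (2 * (c * a))) at_top"
  proof (rule ln_abs_over_tendsto)
    show "0 < C\<^sub>1 / 2 / c" "0 < 9 * C\<^sub>2 / c" using assms by simp_all
    show "\<forall>\<^sub>F \<tau> in at_top. C\<^sub>1 / 2 / c * \<tau> powr \<mu>\<^sub>1 \<le> \<bar>indicator_fun a c T u \<tau>\<bar> * exp (2 * (c * a) * \<tau>)"
      using lower
    proof eventually_elim
      case (elim \<tau>)
      from divide_right_mono[OF elim, of c] show ?case using assms(2) by (simp add: ind)
    qed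
    show "\<forall>\<^sub>F \<tau> in at_top. \<bar>indicator_fun a c T u \<tau>\<bar> * exp (2 * (c * a) * \<tau>) \<le> 9 * C\<^sub>2 / c * \<tau> powr \<mu>\<^sub>2"
      using upper
    proof eventually_elim
      case (elim \<tau>)
      from divide_right_mono[OF elim, of c] show ?case using assms(2) by (simp add: ind)
    qed
  qed
  then show ?thesis by (simp add: mult.assoc)
qed

end
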